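(* Let $c=e^{2\pi i\theta}$, where $\theta\neq0$ is rational and for all $p\in\mathbb N$ and $q\in\mathbb Z$, $\theta\neq\frac{3q+1}{3(6p-1)}$ and $\theta\neq\frac{3q-1}{3(6p-1)}$. Then $$\lim_{n\to\infty}J(P_{n,c})=S^1.$$
   Context: For an integer $n\ge 2$ and $c\in\mathbb C$, $P_{n,c}:\mathbb C\to\mathbb C$ is $P_{n,c}(z)=z^n+c$. The filled Julia set $K(P_{n,c})$ is the set of $z\in\mathbb C$ whose forward orbit under iteration of $P_{n,c}$ is bounded, and the Julia set $J(P_{n,c})$ is the topological boundary of $K(P_{n,c})$; it is a nonempty compact set. $S^1=\{z\in\mathbb C:|z|=1\}$ and $\mathbb N=\{1,2,3,\dots\}$. Limits of sets are with respect to the Hausdorff metric on nonempty compact subsets of $\mathbb C$, $d_{\mathcal H}(A,B)=\max\{\sup_{a\in A}\inf_{b\in B}|a-b|,\ \sup_{b\in B}\inf_{a\in A}|a-b|\}$: $\lim_{n\to\infty}S_n=S$ means that for all $\epsilon>0$ there is $N>0$ such that $d_{\mathcal H}(S_n,S)<\epsilon$ for all $n\ge N$. *)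

theory Defs
  imports "HOL-Analysis.Analysis" "HOL-Computational_Algebra.Fundamental_Theorem_Algebra"
begin

definition pmap :: "nat \<Rightarrow> complex \<Rightarrow> complex \<Rightarrow> complex" where
  "pmap n c z = z ^ n + c"

definition filled_julia :: "(complex \<Rightarrow> complex) \<Rightarrow> complex set" where
  "filled_julia f = {z. bounded (range (\<lambda>k. (f ^^ k) z))}"

definition julia :: "(complex \<Rightarrow> complex) \<Rightarrow> complex set" where
  "julia f = frontier (filled_julia f)"

(* A metric on nonempty compact sets only: on empty or unbounded sets, infdist and the
   real-valued suprema take unspecified or default values. The lemmas julia_compact and
   julia_nonempty below show that the Julia sets in question lie in its domain. *)
definition hausdorff_distance :: "'a::metric_space set \<Rightarrow> 'a set \<Rightarrow> real" where
  "hausdorff_distance A B = max (SUP a\<in>A. infdist a B) (SUP b\<in>B. infdist b A)"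

definition hausdorff_limit :: "(nat \<Rightarrow> 'a::metric_space set) \<Rightarrow> 'a set \<Rightarrow> bool" where
  "hausdorff_limit S L \<longleftrightarrow>
     (\<forall>\<epsilon>>0. \<exists>N>0. \<forall>n\<ge>N. hausdorff_distance (S n) L < \<epsilon>)"

lemma pmap_growth:
  assumes "n \<ge> 2" "norm z \<ge> 2 + norm c"
  shows "norm (pmap n c z) \<ge> 2 + norm c" "norm (pmap n c z) \<ge> norm z + 1"
proof -
  have 1: "norm z \<ge> 1" using assms(2) norm_ge_zero[of c] by linarith
  have "norm z ^ 2 \<le> norm z ^ n" using 1 assms(1) by (rule power_increasing[rotated])
  moreover have "norm z ^ 2 \<ge> (2 + norm c) * norm z"
    using mult_right_mono[OF assms(2) norm_ge_zero[of z]] by (simp add: power2_eq_square)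
  moreover have "norm c * norm z \<ge> norm c * 1"
    by (rule mult_left_mono[OF 1]) simp
  moreover have "norm (pmap n c z) \<ge> norm z ^ n - norm c"
    using norm_diff_ineq[of "z ^ n" c] by (simp add: pmap_def norm_power)
  ultimately show *: "norm (pmap n c z) \<ge> norm z + 1"
    using 1 assms(2) norm_ge_zero[of c] distrib_right[of 2 "norm c" "norm z"] by linarith
  show "norm (pmap n c z) \<ge> 2 + norm c" using * assms(2) by linarith
qed

lemma filled_julia_subset:
  assumes "n \<ge> 2"
  shows "filled_julia (pmap n c) \<subseteq> cball 0 (2 + norm c)"
proof (rule subsetI, rule ccontr)
  fix z assume z: "z \<in> filled_julia (pmap n c)" and "z \<notin> cball 0 (2 + norm c)"
  then have big: "norm z \<ge> 2 + norm c" by simp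
  have "norm ((pmap n c ^^ k) z) \<ge> 2 + norm c \<and> norm ((pmap n c ^^ k) z) \<ge> real k" for k
  proof (induction k)
    case 0
    then show ?case using big by simp
  next
    case (Suc k)
    then show ?case using pmap_growth[OF assms, of c "(pmap n c ^^ k) z"] by auto
  qed
  moreover obtain B where "\<And>k. norm ((pmap n c ^^ k) z) \<le> B"
    using z by (auto simp: filled_julia_def bounded_iff)
  moreover obtain k where "real k > B" using reals_Archimedean2 by blast
  ultimately show False by (meson leD order.trans)
qed

lemma julia_compact:
  assumes "n \<ge> 2"
  shows "compact (julia (pmap n c))"
proof -
  have "bounded (filled_julia (pmap n c))"
    using filled_julia_subset[OF assms] bounded_cball bounded_subset by blast
  then show ?thesis by (simp add: julia_def compact_frontier_bounded)
qed

lemma filled_julia_nonempty: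
  assumes "n \<ge> 2"
  shows "filled_julia (pmap n c) \<noteq> {}"
proof -
  define p where "p = monom 1 n + [:c, -1:]"
  have "degree p = n"
    using assms by (simp add: p_def degree_add_eq_left degree_monom_eq)
  then have "\<not> constant (poly p)" using assms by (simp add: constant_degree)
  then obtain z where "poly p z = 0" using fundamental_theorem_of_algebra by blast
  then have "pmap n c z = z" by (simp add: p_def pmap_def poly_monom algebra_simps)
  then have "(pmap n c ^^ k) z = z" for k by (induction k) auto
  then have "z \<in> filled_julia (pmap n c)" by (simp add: filled_julia_def)
  then show ?thesis by blast
qed

lemma julia_nonempty:
  assumes "n \<ge> 2"
  shows "julia (pmap n c) \<noteq> {}"
proof -
  have "bounded (filled_julia (pmap n c))"
    using filled_julia_subset[OF assms] bounded_cball bounded_subset by blast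
  then have "filled_julia (pmap n c) \<noteq> UNIV" using not_bounded_UNIV by metis
  then show ?thesis
    using filled_julia_nonempty[OF assms] frontier_not_empty by (auto simp: julia_def)
qed

end

theory Submission
  imports Defs
begin

text \<open>
  Write \<open>P = pmap n c\<close>, \<open>K\<close> for its filled Julia set and \<open>J\<close> for its Julia set. Since \<open>K\<close> depends
  on a point only through its \<open>n\<close>-th power, \<open>J\<close> is invariant under rotation by \<open>n\<close>-th roots of
  unity. As \<open>J\<close> is nonempty, it comes within \<open>2 * pi / n + \<delta>\<close> of every point of the circle as soon
  as it lies in the annulus \<open>1 - \<delta> \<le> norm z \<le> 1 + \<delta>\<close>. So convergence to the circle amounts to \<open>J\<close>
  being contained in arbitrarily thin annuli (\<open>hausdorff_distance_circle_le\<close>).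

  The outer bound holds because \<open>norm z ^ n\<close> exceeds every constant when \<open>norm z \<ge> \<rho> > 1\<close> and \<open>n\<close>
  is large. For the inner bound it suffices that, for each \<open>r < 1\<close> and all large \<open>n\<close>, the disc of
  radius \<open>r\<close> is either contained in \<open>K\<close> or disjoint from it. The first iterate of that disc is within
  \<open>r ^ n\<close> of \<open>c\<close>, and as long as the orbit \<open>c\<close>, \<open>c ^ n + c\<close>, ... of \<open>c\<close> stays in the
  closed unit disc, each further iterate loses only a factor \<open>3 * n\<close> (\<open>shadows_Suc\<close>). The disc thus
  shadows the orbit of \<open>c\<close> with exponentially small error until that orbit leaves the unit
  circle: inwards, and the disc is mapped into itself, or outwards, and it escapes
  (\<open>dichotomy_if_shadows\<close>).

  It remains to see that the orbit of \<open>c\<close> does leave the circle. As \<open>c\<close> is a root of unity, the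
  first few points of this orbit depend only on the residue of \<open>n\<close> modulo a fixed multiple of 6, so
  all is uniform in \<open>n\<close>. If \<open>c ^ n + c\<close> is unimodular, it equals \<open>c * y\<close> with \<open>y\<close> a primitive sixth
  root of unity, and the next point is \<open>c * (1 + y ^ (n + 2))\<close>. This is off the circle
  unless \<open>n\<close> is 0 or 2 modulo 6. For \<open>n\<close> equal to 2 modulo 6 the point after it is \<open>2 * c\<close>; for \<open>n\<close>
  divisible by 6 the point \<open>c * y\<close> is fixed, and this is exactly what the condition on \<open>\<theta>\<close>
  excludes.
\<close>

section \<open>Symmetry and Hausdorff distance to the circle\<close>

lemma filled_julia_iterate_iff:
  "(f ^^ j) z \<in> filled_julia f \<longleftrightarrow> z \<in> filled_julia f"
proof -
  have "range (\<lambda>k. (f ^^ k) z) = (\<lambda>k. (f ^^ k) z) ` {..<j} \<union> range (\<lambda>k. (f ^^ k) ((f ^^ j) z))"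
  proof (intro equalityI subsetI)
    fix x assume "x \<in> range (\<lambda>k. (f ^^ k) z)"
    then obtain k where k: "x = (f ^^ k) z" by blast
    show "x \<in> (\<lambda>k. (f ^^ k) z) ` {..<j} \<union> range (\<lambda>k. (f ^^ k) ((f ^^ j) z))"
    proof (cases "k < j")
      case False
      then have "x = (f ^^ (k - j)) ((f ^^ j) z)"
        using k funpow_add[of "k - j" j f] by simp
      then show ?thesis by blast
    qed (use k in auto)
  next
    fix x assume "x \<in> (\<lambda>k. (f ^^ k) z) ` {..<j} \<union> range (\<lambda>k. (f ^^ k) ((f ^^ j) z))"
    then show "x \<in> range (\<lambda>k. (f ^^ k) z)"
      by (auto simp flip: funpow_add[THEN fun_cong, unfolded o_apply])
  qed
  then show ?thesis
    by (simp add: filled_julia_def finite_imp_bounded)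
qed

lemma filled_julia_rotate:
  assumes "\<zeta> ^ n = 1"
  shows "\<zeta> * z \<in> filled_julia (pmap n c) \<longleftrightarrow> z \<in> filled_julia (pmap n c)"
  using filled_julia_iterate_iff[of 1 "pmap n c" z] filled_julia_iterate_iff[of 1 "pmap n c" "\<zeta> * z"]
  by (simp add: pmap_def power_mult_distrib assms)

lemma julia_rotate:
  assumes "\<zeta> ^ n = 1" "norm \<zeta> = 1" "z \<in> julia (pmap n c)"
  shows "\<zeta> * z \<in> julia (pmap n c)"
proof -
  have d: "dist (\<zeta> * z) (\<zeta> * x) = dist z x" for x
    using assms(2) by (simp add: dist_norm norm_mult flip: right_diff_distrib)
  show ?thesis
    using assms(3) unfolding julia_def frontier_straddle
    by (metis d filled_julia_rotate[OF assms(1)])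
qed

lemma norm_cis_diff_le: "norm (cis s - cis t) \<le> \<bar>s - t\<bar>"
proof -
  have "cis s - cis t = cis t * (cis (s - t) - 1)"
    by (simp add: right_diff_distrib cis_mult)
  then have "norm (cis s - cis t) = norm (exp (\<i> * of_real (s - t)) - 1)"
    by (simp only: norm_mult norm_cis mult_1 flip: cis_conv_exp)
  also have "\<dots> = 2 * \<bar>sin ((s - t) / 2)\<bar>" by (rule dist_exp_i_1)
  also have "\<dots> \<le> 2 * \<bar>(s - t) / 2\<bar>" by (intro mult_left_mono abs_sin_x_le_abs_x) simp
  finally show ?thesis by simp
qed

lemma root_of_unity_near:
  fixes a :: complex
  assumes "norm a = 1" "n > 0"
  obtains \<zeta> where "\<zeta> ^ n = 1" "norm \<zeta> = 1" "norm (\<zeta> - a) \<le> 2 * pi / real n"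
proof
  define t where "t = Arg a"
  have a: "a = cis t" using assms(1) cis_Arg[of a] by (force simp: t_def sgn_div_norm)
  define k where "k = \<lfloor>t * n / (2 * pi)\<rfloor>"
  define \<zeta> where "\<zeta> = cis (2 * pi * k / n)"
  have "\<zeta> ^ n = cis (2 * pi * k)" using assms(2) by (simp add: \<zeta>_def Complex.DeMoivre)
  then show "\<zeta> ^ n = 1" by (simp add: cis_multiple_2pi)
  show "norm \<zeta> = 1" by (simp add: \<zeta>_def)
  have "\<bar>k - t * n / (2 * pi)\<bar> \<le> 1" unfolding k_def by linarith
  moreover have "2 * pi * k / n - t = (2 * pi / n) * (k - t * n / (2 * pi))"
    using assms(2) by (simp add: field_simps)
  ultimately have "\<bar>2 * pi * k / n - t\<bar> \<le> (2 * pi / n) * 1"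
    using mult_left_mono[of "\<bar>k - t * n / (2 * pi)\<bar>" 1 "2 * pi / n"] by (simp add: abs_mult)
  then show "norm (\<zeta> - a) \<le> 2 * pi / n"
    unfolding \<zeta>_def a using norm_cis_diff_le order.trans by fastforce
qed

lemma dist_sgn:
  fixes z :: complex
  assumes "z \<noteq> 0"
  shows "dist z (sgn z) = \<bar>norm z - 1\<bar>"
proof -
  have "z - sgn z = (norm z - 1) *\<^sub>R sgn z"
    using assms by (simp add: sgn_div_norm scaleR_left_diff_distrib left_diff_distrib)
  then show ?thesis using assms by (simp add: dist_norm norm_sgn)
qed

text \<open>An annulus around the circle that contains the Julia set controls both halves of the Hausdorff
  distance, thanks to the rotational symmetry.\<close>

lemma hausdorff_distance_circle_le:
  assumes n: "n \<ge> 2" and "\<delta> < 1"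
    and annulus: "\<And>z. z \<in> julia (pmap n c) \<Longrightarrow> \<bar>norm z - 1\<bar> \<le> \<delta>"
  shows "hausdorff_distance (julia (pmap n c)) (sphere 0 1) \<le> \<delta> + 2 * pi / n"
  unfolding hausdorff_distance_def
proof (intro max.boundedI cSUP_least)
  show "julia (pmap n c) \<noteq> {}" using n by (rule julia_nonempty)
  show "sphere (0::complex) 1 \<noteq> {}" by simp
  have nz: "z \<noteq> 0" if "z \<in> julia (pmap n c)" for z using annulus[OF that] assms(2) by auto
  fix z assume z: "z \<in> julia (pmap n c)"
  have "infdist z (sphere 0 1) \<le> dist z (sgn z)"
    by (rule infdist_le) (simp add: norm_sgn nz[OF z])
  also have "\<dots> \<le> \<delta>" using annulus[OF z] by (simp add: dist_sgn nz[OF z])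
  finally show "infdist z (sphere 0 1) \<le> \<delta> + 2 * pi / n"
    by (rule order_trans) simp
next
  fix b :: complex assume "b \<in> sphere 0 1"
  then have b: "norm b = 1" by simp
  obtain z where z: "z \<in> julia (pmap n c)" using julia_nonempty[OF n] by blast
  have nz: "z \<noteq> 0" using annulus[OF z] assms(2) by auto
  obtain \<zeta> where \<zeta>: "\<zeta> ^ n = 1" "norm \<zeta> = 1" "norm (\<zeta> - b / sgn z) \<le> 2 * pi / n"
    using root_of_unity_near[of "b / sgn z" n] b n nz by (auto simp: norm_divide norm_sgn)
  have "infdist b (julia (pmap n c)) \<le> dist b (\<zeta> * z)"
    by (rule infdist_le) (rule julia_rotate[OF \<zeta>(1,2) z])
  also have "\<dots> \<le> dist (\<zeta> * z) (\<zeta> * sgn z) + dist (\<zeta> * sgn z) b"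
    by (metis dist_commute dist_triangle)
  also have "dist (\<zeta> * z) (\<zeta> * sgn z) = dist z (sgn z)"
    using \<zeta>(2) by (simp add: dist_norm norm_mult flip: right_diff_distrib)
  also have "dist (\<zeta> * sgn z) b = norm ((\<zeta> - b / sgn z) * sgn z)"
    using nz by (simp add: dist_norm left_diff_distrib sgn_zero_iff)
  also have "\<dots> = norm (\<zeta> - b / sgn z)" using nz by (simp add: norm_mult norm_sgn)
  finally show "infdist b (julia (pmap n c)) \<le> \<delta> + 2 * pi / n"
    using \<zeta>(3) annulus[OF z] nz by (simp add: dist_sgn)
qed

section \<open>Escape and trapping\<close>

lemma eventually_filled_julia_subset_ball:
  assumes "\<rho> > 1"
  shows "\<forall>\<^sub>F n in sequentially. filled_julia (pmap n c) \<subseteq> ball 0 \<rho>"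
proof -
  have "filterlim (\<lambda>n. \<rho> ^ n) at_top sequentially"
    using assms by (auto simp: filterlim_at_infinity_imp_filterlim_at_top filterlim_realpow_sequentially_gt1)
  then have "\<forall>\<^sub>F n in sequentially. \<rho> ^ n > 2 + 2 * norm c"
    by (simp add: filterlim_at_top_dense)
  then show ?thesis using eventually_ge_at_top[of 2]
  proof eventually_elim
    case (elim n)
    show ?case
    proof (rule subsetI, rule ccontr)
      fix z assume z: "z \<in> filled_julia (pmap n c)" and "z \<notin> ball 0 \<rho>"
      then have "\<rho> ^ n \<le> norm z ^ n" using assms by (intro power_mono) auto
      moreover have "norm (pmap n c z) \<ge> norm z ^ n - norm c"
        using norm_diff_ineq[of "z ^ n" c] by (simp add: pmap_def norm_power)
      moreover have "pmap n c z \<in> cball 0 (2 + norm c)"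
        using filled_julia_subset[OF elim(2), of c] filled_julia_iterate_iff[of 1 "pmap n c" z] z by auto
      ultimately show False using elim(1) by auto
    qed
  qed
qed

lemma subset_filled_julia_if_invariant:
  assumes "compact D" "(pmap n c ^^ Suc j) ` D \<subseteq> D"
  shows "D \<subseteq> filled_julia (pmap n c)"
proof
  fix z assume z: "z \<in> D"
  let ?f = "pmap n c"
  have inv: "(?f ^^ (Suc j * q)) z \<in> D" for q
  proof (induction q)
    case (Suc q)
    have "(?f ^^ (Suc j * Suc q)) z = (?f ^^ Suc j) ((?f ^^ (Suc j * q)) z)"
      by (metis funpow_add comp_apply mult_Suc_right)
    then show ?case using Suc assms(2) by blast
  qed (use z in simp)
  have "range (\<lambda>k. (?f ^^ k) z) \<subseteq> (\<Union>s\<le>j. (?f ^^ s) ` D)"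
  proof clarify
    fix k
    have "(?f ^^ k) z = (?f ^^ (k mod Suc j)) ((?f ^^ (Suc j * (k div Suc j))) z)"
      by (metis funpow_add comp_apply mod_mult_div_eq)
    then show "(?f ^^ k) z \<in> (\<Union>s\<le>j. (?f ^^ s) ` D)"
      using inv by (force simp: less_Suc_eq_le intro!: bexI[of _ "k mod Suc j"])
  qed
  moreover have "continuous_on A (?f ^^ s)" for s A
    by (induction s arbitrary: A)
      (auto simp: pmap_def[abs_def] o_def intro!: continuous_intros)
  then have "bounded (\<Union>s\<le>j. (?f ^^ s) ` D)"
    using assms(1) by (auto intro!: compact_imp_bounded compact_continuous_image)
  ultimately show "z \<in> filled_julia ?f"
    unfolding filled_julia_def using bounded_subset by blast
qed

section \<open>Shadowing the orbit of c\<close>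

lemma norm_power_diff_le:
  fixes u v :: complex
  assumes "norm v \<le> 1" "norm (u - v) \<le> \<delta>" "n * \<delta> \<le> 1"
  shows "norm (u ^ n - v ^ n) \<le> 3 * real n * \<delta>"
proof -
  have \<delta>: "\<delta> \<ge> 0" using assms(2) norm_ge_zero order.trans by blast
  \<comment> \<open>Both points lie in the disc of radius \<open>R\<close>; after scaling by \<open>R\<close> the power map is
    \<open>n\<close>-Lipschitz, and \<open>R ^ n \<le> exp (n * \<delta>) \<le> exp 1 \<le> 3\<close>.\<close>
  define R where "R = 1 + \<delta>"
  have R: "R \<ge> 1" using \<delta> by (simp add: R_def)
  have u: "norm u \<le> R" using assms(1,2) norm_triangle_sub[of u v] by (simp add: R_def)
  have "norm ((u / of_real R) ^ n - (v / of_real R) ^ n) \<le> n * norm (u / of_real R - v / of_real R)"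
    using R u assms(1) by (intro norm_power_diff) (auto simp: norm_divide)
  also have "\<dots> = n * (norm (u - v) / R)"
    using R by (simp add: norm_divide flip: diff_divide_distrib)
  also have "\<dots> \<le> n * \<delta>"
  proof (rule mult_left_mono)
    have "norm (u - v) / R \<le> norm (u - v) / 1" using R by (intro divide_left_mono) auto
    then show "norm (u - v) / R \<le> \<delta>" using assms(2) by simp
  qed simp
  finally have "norm (u ^ n - v ^ n) / R ^ n \<le> n * \<delta>"
    using R by (simp add: power_divide norm_divide norm_power flip: diff_divide_distrib)
  then have "norm (u ^ n - v ^ n) \<le> n * \<delta> * R ^ n" using R by (simp add: field_simps)
  also have "\<dots> \<le> n * \<delta> * 3"
  proof (rule mult_left_mono)
    have "R ^ n \<le> exp \<delta> ^ n" using R by (intro power_mono) (auto simp: R_def)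
    also have "\<dots> = exp (n * \<delta>)" by (simp add: exp_of_nat_mult)
    also have "\<dots> \<le> exp 1" using assms(3) by simp
    finally show "R ^ n \<le> 3" using exp_le by linarith
  qed (use \<delta> in simp)
  finally show ?thesis by (simp add: mult_ac)
qed

text \<open>Along the degrees satisfying \<open>A\<close>, the iterate number \<open>i + 1\<close> of every closed disc of radius
  \<open>r < 1\<close> eventually lies within \<open>(3 * n) ^ i * r ^ n\<close> of the point \<open>b\<close>.\<close>

definition shadows :: "complex \<Rightarrow> (nat \<Rightarrow> bool) \<Rightarrow> nat \<Rightarrow> complex \<Rightarrow> bool" where
  "shadows c A i b \<longleftrightarrow> (\<forall>r. 0 < r \<and> r < 1 \<longrightarrow> (\<forall>\<^sub>F n in sequentially. A n \<longrightarrow>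
     (\<forall>z. norm z \<le> r \<longrightarrow> norm ((pmap n c ^^ Suc i) z - b) \<le> (3 * real n) ^ i * r ^ n)))"

lemma shadows_0: "shadows c A 0 c"
  by (simp add: shadows_def pmap_def norm_power power_mono)

lemma shadows_error_tendsto_0:
  assumes "0 < r" "r < 1"
  shows "(\<lambda>n. (3 * real n) ^ i * r ^ n) \<longlonglongrightarrow> 0"
proof (cases "i = 0")
  case True
  then show ?thesis using assms by (simp add: LIMSEQ_realpow_zero)
next
  case False
  \<comment> \<open>The sequence is the \<open>i\<close>-th power of \<open>3 * n * s ^ n\<close> with \<open>s\<close> the \<open>i\<close>-th root of \<open>r\<close>.\<close>
  define s where "s = root i r"
  have s: "s ^ i = r" "norm s < 1" using assms False by (auto simp: s_def)
  have "(\<lambda>n. (3 * (real n * s ^ n)) ^ i) \<longlonglongrightarrow> (3 * 0) ^ i"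
    using s(2) by (intro tendsto_intros powser_times_n_limit_0)
  moreover have "(3 * (real n * s ^ n)) ^ i = (3 * real n) ^ i * r ^ n" for n
    by (simp only: power_mult_distrib mult.assoc flip: s(1) power_mult)
      (simp only: mult.commute)
  ultimately show ?thesis using False by (simp only: mult_zero_right power_0_left if_False)
qed

lemma shadows_Suc:
  assumes "shadows c A i b" "norm b \<le> 1"
    and b': "\<forall>\<^sub>F n in sequentially. A n \<longrightarrow> b ^ n + c = b'"
  shows "shadows c A (Suc i) b'"
  unfolding shadows_def
proof (intro allI impI, elim conjE)
  fix r :: real assume r: "0 < r" "r < 1"
  have "\<forall>\<^sub>F n in sequentially. (3 * real n) ^ Suc i * r ^ n < 1"
    using shadows_error_tendsto_0[OF r] by (rule order_tendstoD) simp
  moreover have "\<forall>\<^sub>F n in sequentially. A n \<longrightarrow>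
     (\<forall>z. norm z \<le> r \<longrightarrow> norm ((pmap n c ^^ Suc i) z - b) \<le> (3 * real n) ^ i * r ^ n)"
    using assms(1) r by (simp add: shadows_def)
  ultimately show "\<forall>\<^sub>F n in sequentially. A n \<longrightarrow> (\<forall>z. norm z \<le> r \<longrightarrow>
      norm ((pmap n c ^^ Suc (Suc i)) z - b') \<le> (3 * real n) ^ Suc i * r ^ n)"
    using b'
  proof eventually_elim
    case (elim n)
    show ?case
    proof (intro impI allI)
      fix z :: complex assume A: "A n" and z: "norm z \<le> r"
      define w where "w = (pmap n c ^^ Suc i) z"
      let ?\<delta> = "(3 * real n) ^ i * r ^ n"
      have "real n * ?\<delta> \<le> 3 * real n * ?\<delta>" using r by simp
      then have "real n * ?\<delta> \<le> 1" using elim(1) by (simp add: mult_ac)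
      then have "norm (w ^ n - b ^ n) \<le> 3 * real n * ?\<delta>"
        using elim(2) A z assms(2) by (intro norm_power_diff_le) (auto simp: w_def)
      moreover have "(pmap n c ^^ Suc (Suc i)) z - b' = w ^ n - b ^ n"
        using elim(3) A by (auto simp: w_def pmap_def)
      ultimately show "norm ((pmap n c ^^ Suc (Suc i)) z - b') \<le> (3 * real n) ^ Suc i * r ^ n"
        by (simp add: mult_ac)
    qed
  qed
qed

text \<open>The disc of radius \<open>r\<close> is dynamically homogeneous: all its points have bounded orbit, or none.\<close>

definition dichotomy :: "complex \<Rightarrow> real \<Rightarrow> nat \<Rightarrow> bool" where
  "dichotomy c r n \<longleftrightarrow>
     cball 0 r \<subseteq> filled_julia (pmap n c) \<or> cball 0 r \<inter> filled_julia (pmap n c) = {}"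

lemma dichotomy_mono: "dichotomy c r' n \<Longrightarrow> r \<le> r' \<Longrightarrow> dichotomy c r n"
  unfolding dichotomy_def using subset_cball[of r r' "0::complex"] by blast

lemma dichotomy_if_shadows:
  assumes "shadows c A i b" "norm b \<noteq> 1" "r < 1"
  shows "\<forall>\<^sub>F n in sequentially. A n \<longrightarrow> dichotomy c r n"
proof -
  \<comment> \<open>Enlarge the disc so that it has positive radius and contains \<open>b\<close> in its interior in the
    attracting case.\<close>
  define r' where "r' = max (max r (1 / 2)) (if norm b < 1 then (1 + norm b) / 2 else 0)"
  have r': "0 < r'" "r' < 1" "r \<le> r'" and b: "norm b < 1 \<Longrightarrow> norm b < r'"
    using assms(3) by (auto simp: r'_def less_max_iff_disj)
  define d where "d = (if norm b < 1 then r' - norm b else (norm b - 1) / 2)"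
  have d: "d > 0" using b assms(2) by (auto simp: d_def)
  have sh: "\<forall>\<^sub>F n in sequentially. A n \<longrightarrow> (\<forall>z. norm z \<le> r' \<longrightarrow>
      norm ((pmap n c ^^ Suc i) z - b) \<le> (3 * real n) ^ i * r' ^ n)"
    using assms(1) r' by (simp add: shadows_def)
  have "\<forall>\<^sub>F n in sequentially. (3 * real n) ^ i * r' ^ n < d"
    using shadows_error_tendsto_0[OF r'(1,2)] d by (rule order_tendstoD)
  with sh have close: "\<forall>\<^sub>F n in sequentially. A n \<longrightarrow> (\<forall>z. norm z \<le> r' \<longrightarrow>
      norm ((pmap n c ^^ Suc i) z - b) < d)"
    by eventually_elim (use le_less_trans in blast)
  show ?thesis
  proof (cases "norm b < 1")
    case True
    from close show ?thesis
    proof eventually_elim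
      case (elim n)
      show ?case
      proof
        assume A: "A n"
        have "norm ((pmap n c ^^ Suc i) z) \<le> r'" if "norm z \<le> r'" for z
          using elim A that True norm_triangle_sub[of "(pmap n c ^^ Suc i) z" b]
          by (fastforce simp: d_def)
        then have "cball 0 r' \<subseteq> filled_julia (pmap n c)"
          by (intro subset_filled_julia_if_invariant[where j = i]) auto
        then have "dichotomy c r' n" by (simp add: dichotomy_def)
        then show "dichotomy c r n" using r'(3) by (rule dichotomy_mono)
      qed
    qed
  next
    case False
    have "(norm b + 1) / 2 > 1" using False assms(2) by simp
    from close eventually_filled_julia_subset_ball[OF this, of c] show ?thesis
    proof eventually_elim
      case (elim n)
      show ?case
      proof
        assume A: "A n"
        have "z \<notin> filled_julia (pmap n c)" if "norm z \<le> r'" for z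
        proof
          assume "z \<in> filled_julia (pmap n c)"
          then have "(pmap n c ^^ Suc i) z \<in> filled_julia (pmap n c)"
            by (simp only: filled_julia_iterate_iff)
          then have "norm ((pmap n c ^^ Suc i) z) < (norm b + 1) / 2"
            using elim(2) by (simp only: subset_iff mem_ball_0)
          moreover have "norm ((pmap n c ^^ Suc i) z - b) < (norm b - 1) / 2"
            using elim(1) A that False by (simp add: d_def)
          ultimately show False
            using norm_triangle_sub[of b "(pmap n c ^^ Suc i) z"]
            by (simp add: norm_minus_commute field_simps)
        qed
        then have "dichotomy c r' n" by (auto simp: dichotomy_def)
        then show "dichotomy c r n" using r'(3) by (rule dichotomy_mono)
      qed
    qed
  qed
qed

lemma julia_outside_if_dichotomy:
  assumes "dichotomy c r n" "z \<in> julia (pmap n c)"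
  shows "norm z \<ge> r"
proof (rule ccontr)
  assume "\<not> norm z \<ge> r"
  then have e: "r - norm z > 0" by simp
  have in_disc: "x \<in> cball 0 r" if "dist z x < r - norm z" for x
    using that norm_triangle_sub[of x z] by (simp add: dist_norm norm_minus_commute)
  show False
    using assms e in_disc unfolding julia_def frontier_straddle dichotomy_def by blast
qed

section \<open>The orbit of c leaves the unit circle\<close>

lemma unimodular_sum:
  fixes y :: complex
  assumes "norm y = 1" "norm (y - 1) = 1"
  shows "Re y = 1 / 2" "y\<^sup>2 = y - 1" "y ^ 3 = - 1" "y ^ 6 = 1"
proof -
  have "(Re y)\<^sup>2 + (Im y)\<^sup>2 = 1" "(Re y - 1)\<^sup>2 + (Im y)\<^sup>2 = 1"
    using assms by (auto simp: cmod_def)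
  moreover from this have re: "Re y = 1 / 2" by (simp add: power2_eq_square algebra_simps)
  ultimately have *: "Re y = 1 / 2" "(Im y)\<^sup>2 = 3 / 4" by (simp_all add: power_divide)
  show "Re y = 1 / 2" by fact
  show sq: "y\<^sup>2 = y - 1"
  proof -
    have "(Re y)\<^sup>2 - (Im y)\<^sup>2 = Re y - 1" "2 * Re y * Im y = Im y"
      unfolding * by (simp_all add: power_divide)
    then show ?thesis
      by (simp only: complex_eq_iff Re_power2 Im_power2 minus_complex.sel one_complex.sel) simp
  qed
  have "y ^ 3 = y * y\<^sup>2" by (simp add: power2_eq_square power3_eq_cube)
  also have "\<dots> = y\<^sup>2 - y" by (subst sq) (simp add: algebra_simps power2_eq_square)
  finally show cu: "y ^ 3 = - 1" by (simp add: sq)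
  have "y ^ 6 = (y ^ 3)\<^sup>2" by (simp flip: power_mult)
  then show "y ^ 6 = 1" by (simp add: cu)
qed

lemma power_eq_of_mod_eq:
  fixes x :: "'a::monoid_mult"
  assumes "x ^ M = 1" "n mod M = s mod M"
  shows "x ^ n = x ^ s"
proof -
  have "x ^ k = x ^ (k mod M)" for k
    by (metis assms(1) mod_mult_div_eq mult.right_neutral power_add power_mult power_one)
  then show ?thesis using assms(2) by metis
qed

text \<open>On a residue class of degrees modulo a multiple \<open>M\<close> of both 6 and the order of \<open>c\<close>, the first
  points of the orbit of \<open>c\<close> do not depend on the degree.\<close>

lemma residue_class_dichotomy:
  fixes c :: complex
  assumes c: "norm c = 1" "c ^ M = 1" and M: "6 dvd M" and "r < 1"
    and nonexceptional: "6 dvd s \<Longrightarrow> norm (c ^ s + c) \<noteq> 1"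
  shows "\<forall>\<^sub>F n in sequentially. n mod M = s mod M \<longrightarrow> dichotomy c r n"
proof -
  define A where "A = (\<lambda>n. n mod M = s mod M)"
  have powA: "x ^ n = x ^ s" if "x ^ M = 1" "A n" for x :: complex and n
    using that power_eq_of_mod_eq unfolding A_def by blast
  define b where "b = c ^ s + c"
  have sh1: "shadows c A 1 b"
    using shadows_Suc[OF shadows_0, of c A b] c powA by (simp add: b_def)
  show ?thesis
  proof (cases "norm b = 1")
    case False
    then show ?thesis using dichotomy_if_shadows[OF sh1 _ assms(4)] by (simp add: A_def)
  next
    case True
    have c0: "c \<noteq> 0" using c by auto
    define y where "y = b / c"
    have by': "b = c * y" using c0 by (simp add: y_def)
    have cs: "c ^ s = c * (y - 1)" using c0 by (simp add: y_def b_def field_simps)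
    have "norm y = 1" using True c by (simp add: y_def norm_divide)
    moreover have "norm (c ^ s) = norm c * norm (y - 1)" using cs by (simp add: norm_mult)
    then have "norm (y - 1) = 1" using c by (simp add: norm_power)
    ultimately have y: "norm y = 1" "Re y = 1 / 2" "y\<^sup>2 = y - 1" "y ^ 3 = - 1" "y ^ 6 = 1"
      using unimodular_sum by auto
    have im: "(Im y)\<^sup>2 = 3 / 4"
      using y(1,2) by (simp add: cmod_def power2_eq_square)
    have yM: "y ^ M = 1" using M y(5) by (metis dvdE power_mult power_one)
    then have bM: "b ^ M = 1" using c by (simp add: by' power_mult_distrib)
    define b2 where "b2 = b ^ s + c"
    have sh2: "shadows c A 2 b2"
      using shadows_Suc[OF sh1, of b2] True powA[OF bM] by (simp add: b2_def numeral_2_eq_2)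
    have b2: "b2 = c * (1 + y ^ (s mod 6 + 2))"
    proof -
      have "b ^ s = c * y\<^sup>2 * y ^ s" by (simp add: by' power_mult_distrib cs y(3))
      then have "b2 = c * (1 + y ^ (s + 2))" by (simp add: b2_def power_add power2_eq_square algebra_simps)
      also have "y ^ (s + 2) = y ^ (s mod 6 + 2)"
        by (rule power_eq_of_mod_eq[OF y(5)]) (simp add: mod_simps)
      finally show ?thesis .
    qed
    have y4: "y ^ 4 = - y" and y5: "y ^ 5 = 1 - y" and y7: "y ^ 7 = y"
    proof -
      have "y ^ 4 = y ^ 3 * y" "y ^ 5 = y ^ 3 * y\<^sup>2" "y ^ 7 = y ^ 6 * y"
        by (simp_all flip: power_Suc2 power_add)
      then show "y ^ 4 = - y" "y ^ 5 = 1 - y" "y ^ 7 = y" using y(3-5) by simp_all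
    qed
    have "(norm (1 + y))\<^sup>2 = 3" "(norm (2 - y))\<^sup>2 = 3"
      by (simp_all add: cmod_power2 im y(2) power_divide)
    then have n3: "norm (1 + y) \<noteq> 1" "norm (2 - y) \<noteq> 1" by auto
    have "s mod 6 < 6" by simp
    then consider "s mod 6 = 0" | "s mod 6 = 1" | "s mod 6 = 2" | "s mod 6 = 3" | "s mod 6 = 4"
      | "s mod 6 = 5" by linarith
    then have "norm b2 \<noteq> 1 \<or> s mod 6 = 2"
    proof cases
      case 1
      then show ?thesis using nonexceptional True by (simp add: b_def dvd_eq_mod_eq_0)
    next
      case 2
      then have "s mod 6 + 2 = 3" by simp
      then have "b2 = 0" by (simp only: b2 y(4)) simp
      then show ?thesis by simp
    next
      case 4
      then show ?thesis using n3 by (simp add: b2 y5 norm_mult c)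
    next
      case 5
      then show ?thesis by (simp add: b2 y(5) norm_mult c)
    next
      case 6
      then show ?thesis using n3 by (simp add: b2 y7 norm_mult c)
    qed simp
    then show ?thesis
    proof (elim disjE)
      assume "norm b2 \<noteq> 1"
      then show ?thesis using dichotomy_if_shadows[OF sh2 _ assms(4)] by (simp add: A_def)
    next
      \<comment> \<open>Here the orbit stays on the circle for one more step and then reaches \<open>2 * c\<close>.\<close>
      assume s2: "s mod 6 = 2"
      have b2': "b2 = c * y ^ 5" using s2 by (simp add: b2 y4 y5)
      have "b2 ^ s = c * y\<^sup>2 * y ^ (5 * s)"
        by (simp add: b2' power_mult_distrib cs y(3) flip: power_mult)
      also have "\<dots> = c * y ^ (2 + 5 * s)" by (simp only: power_add mult.assoc)
      also have "y ^ (2 + 5 * s) = y ^ 0"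
      proof (rule power_eq_of_mod_eq[OF y(5)])
        show "(2 + 5 * s) mod 6 = 0 mod 6" using s2 by presburger
      qed
      finally have "b2 ^ s + c = 2 * c" by simp
      moreover have b2M: "b2 ^ M = 1"
        by (simp add: b2' power_mult_distrib c(2) flip: power_mult)
          (simp add: mult.commute[of 5] power_mult yM)
      moreover have "norm b2 = 1" by (simp add: b2' norm_mult norm_power c y(1))
      ultimately have "shadows c A 3 (2 * c)"
        using shadows_Suc[OF sh2, of "2 * c"] powA[OF b2M] by (simp add: numeral_3_eq_3 numeral_2_eq_2)
      then show ?thesis
        using dichotomy_if_shadows[of c A 3 "2 * c" r] assms(4) by (simp add: A_def norm_mult c)
    qed
  qed
qed

text \<open>The exceptional angles are those for which \<open>c ^ (6 * p) + c\<close> is unimodular for some \<open>p \<ge> 1\<close>.\<close>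

lemma exceptional_angle:
  fixes \<theta> :: real
  assumes "p \<ge> 1" "norm (cis (2 * pi * \<theta>) ^ (6 * p) + cis (2 * pi * \<theta>)) = 1"
  obtains q :: int where "\<theta> = (3 * real_of_int q + 1) / (3 * (6 * real p - 1))"
  | q :: int where "\<theta> = (3 * real_of_int q - 1) / (3 * (6 * real p - 1))"
proof -
  define m where "m = 6 * real p - 1"
  have m: "m > 0" using assms(1) by (simp add: m_def)
  let ?c = "cis (2 * pi * \<theta>)"
  define x where "x = cis (2 * pi * (m * \<theta>))"
  have "?c ^ (6 * p) = ?c * x"
    unfolding x_def m_def Complex.DeMoivre cis_mult by (simp add: algebra_simps)
  then have "norm (?c * (1 + x)) = 1" using assms(2) by (simp add: algebra_simps)
  then have "norm (1 + x) = 1" by (simp add: norm_mult)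
  then have "Re (1 + x) = 1 / 2" by (intro unimodular_sum) (simp_all add: x_def)
  then have "cos (2 * pi * (m * \<theta>)) = cos (2 * pi / 3)"
    by (simp add: x_def cos_120)
  then obtain q where "q \<in> \<int>" "2 * pi * (m * \<theta>) = 2 * pi / 3 + 2 * q * pi \<or>
      2 * pi * (m * \<theta>) = - (2 * pi / 3) + 2 * q * pi"
    using cos_eq[of "2 * pi * (m * \<theta>)" "2 * pi / 3"] by blast
  then obtain k :: int where "2 * pi * (m * \<theta>) = 2 * pi * (1 / 3 + k) \<or>
      2 * pi * (m * \<theta>) = 2 * pi * (k - 1 / 3)"
    by (auto elim!: Ints_cases simp: algebra_simps)
  then have "m * \<theta> = 1 / 3 + k \<or> m * \<theta> = k - 1 / 3" by simp
  then have "\<theta> = (3 * real_of_int k + 1) / (3 * m) \<or> \<theta> = (3 * real_of_int k - 1) / (3 * m)"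
    using m by (auto simp: field_simps)
  then show ?thesis using that unfolding m_def by blast
qed

section \<open>Convergence to the circle\<close>

theorem corollary1:
  fixes \<theta> :: real and c :: complex
  assumes "\<theta> \<in> \<rat>" and "\<theta> \<noteq> 0"
    and "\<And>(p::nat) (q::int). p \<ge> 1 \<Longrightarrow>
           \<theta> \<noteq> (3 * real_of_int q + 1) / (3 * (6 * real p - 1))"
    and "\<And>(p::nat) (q::int). p \<ge> 1 \<Longrightarrow>
           \<theta> \<noteq> (3 * real_of_int q - 1) / (3 * (6 * real p - 1))"
    and "c = exp (2 * of_real pi * \<i> * of_real \<theta>)"
  shows "hausdorff_limit (\<lambda>n. julia (pmap n c)) (sphere 0 1)"
proof -
  have c: "c = cis (2 * pi * \<theta>)" using assms(5) by (simp add: cis_conv_exp mult_ac)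
  have nc: "norm c = 1" by (simp add: c)
  obtain a d :: int where d: "d > 0" "\<theta> = a / d"
    using assms(1) by (auto elim!: Rats_cases')
  define M where "M = 6 * nat d"
  have "real (nat d) * (2 * pi * \<theta>) = 2 * pi * a" using d by simp
  then have "c ^ nat d = cis (2 * pi * a)" by (simp only: c Complex.DeMoivre)
  then have "c ^ nat d = 1" by (simp add: cis_multiple_2pi)
  then have cM: "c ^ M = 1" by (simp add: M_def mult.commute[of 6] power_mult)
  have M: "M > 0" "6 dvd M" using d by (auto simp: M_def)
  have dich: "\<forall>\<^sub>F n in sequentially. dichotomy c r n" if "r < 1" for r
  proof -
    have "\<forall>\<^sub>F n in sequentially. n mod M = s mod M \<longrightarrow> dichotomy c r n" if "s \<in> {1..M}" for s
    proof (rule residue_class_dichotomy[OF nc cM M(2) \<open>r < 1\<close>])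
      assume "6 dvd s"
      then obtain p where "s = 6 * p" by (rule dvdE)
      moreover from this have "p \<ge> 1" using that by (cases p) auto
      ultimately show "norm (c ^ s + c) \<noteq> 1"
        using exceptional_angle[of p \<theta> False] assms(3,4)[of p] unfolding c by blast
    qed
    then have "\<forall>\<^sub>F n in sequentially. \<forall>s\<in>{1..M}. n mod M = s mod M \<longrightarrow> dichotomy c r n"
      by (intro eventually_ball_finite) auto
    then show ?thesis
    proof eventually_elim
      case (elim n)
      \<comment> \<open>The class of 0 is represented by \<open>M\<close>, since the angle condition only covers \<open>s = 6 * p\<close> with
        \<open>p \<ge> 1\<close>.\<close>
      have "\<exists>s\<in>{1..M}. n mod M = s mod M"
      proof (cases "n mod M = 0")
        case False
        then show ?thesis using M(1) by (intro bexI[of _ "n mod M"]) (auto simp: less_imp_le)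
      qed (use M(1) in \<open>auto intro!: bexI[of _ M]\<close>)
      then show ?case using elim by blast
    qed
  qed
  show ?thesis
    unfolding hausdorff_limit_def
  proof (intro allI impI)
    fix \<epsilon> :: real assume "\<epsilon> > 0"
    define \<delta> where "\<delta> = min (\<epsilon> / 2) (1 / 2)"
    have \<delta>: "0 < \<delta>" "\<delta> < 1" "\<delta> \<le> \<epsilon> / 2" using \<open>\<epsilon> > 0\<close> by (auto simp: \<delta>_def)
    have "(\<lambda>n. 2 * pi / real n) \<longlonglongrightarrow> 0" by (rule lim_const_over_n)
    then have small: "\<forall>\<^sub>F n in sequentially. 2 * pi / real n < \<epsilon> / 2"
      by (rule order_tendstoD) (use \<open>\<epsilon> > 0\<close> in simp)
    have "1 - \<delta> < 1" "1 + \<delta> > 1" using \<delta> by auto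
    from small dich[OF this(1)] eventually_filled_julia_subset_ball[OF this(2), of c]
      eventually_ge_at_top[of 2]
    have "\<forall>\<^sub>F n in sequentially. hausdorff_distance (julia (pmap n c)) (sphere 0 1) < \<epsilon>"
    proof eventually_elim
      case (elim n)
      have "\<bar>norm z - 1\<bar> \<le> \<delta>" if "z \<in> julia (pmap n c)" for z
      proof -
        have "z \<in> closure (filled_julia (pmap n c))"
          using that by (simp add: julia_def frontier_def)
        also have "\<dots> \<subseteq> cball 0 (1 + \<delta>)"
          using elim(3) ball_subset_cball by (intro closure_minimal) auto
        finally show ?thesis
          using julia_outside_if_dichotomy[OF elim(2) that] by auto
      qed
      then show ?case
        using hausdorff_distance_circle_le[OF elim(4) \<delta>(2)] elim(1) \<delta>(3) by fastforce
    qed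
    then obtain N where "\<forall>n\<ge>N. hausdorff_distance (julia (pmap n c)) (sphere 0 1) < \<epsilon>"
      by (auto simp: eventually_sequentially)
    then show "\<exists>N>0. \<forall>n\<ge>N. hausdorff_distance (julia (pmap n c)) (sphere 0 1) < \<epsilon>"
      by (intro exI[of _ "Suc N"]) auto
  qed
qed

end
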